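(* For all $m\in\mathcal{M}(W)$, there are natural isomorphisms of $W$-schemes $$\mathbf{V}_m(W)/\!/W\;\cong\;V_{[\frac m2]}(W),$$ where the quotient is taken with respect to the diagonal $W$-action and the $W$-structure on $\mathbf{V}_m(W)/\!/W$ is induced by the right $W$-action. Equivalently, there are $W$-equivariant isomorphisms of commutative $\mathbf{k}$-algebras $$\mathbf{Q}_m(W)^W\;\cong\;Q_{[\frac m2]}(W).$$
   Context: Let $\mathbf{k}$ be a field of characteristic zero, $W$ a finite Coxeter group and $V$ a finite-dimensional $\mathbf{k}$-vector space carrying a reflection representation of $W$. Let $\mathcal{A}$ be the set of reflection hyperplanes; for each fix a linear form $\alpha\in V^*$ with $H_\alpha=\mathrm{Ker}(\alpha)$ (we write $\alpha\in\mathcal{A}$), and let $s_\alpha\in W$ be the corresponding reflection. $\mathcal{M}(W)$ is the set of $W$-invariant functions $m:\mathcal{A}\to\mathbb{Z}_{\ge0}$, $\alpha\mapsto m_\alpha$; $[\frac m2]$ denotes the function $\alpha\mapsto\lfloor m_\alpha/2\rfloor$. Quasi-invariants: $Q_k(W)=\{p\in\mathbf{k}[V]: s_\alpha(p)\equiv p\bmod\langle\alpha\rangle^{2k_\alpha}\ \forall\alpha\in\mathcal{A}\}$, with $W$-action inherited from $\mathbf{k}[V]$; $V_k(W)=\mathrm{Spec}\,Q_k(W)$. Quasi-covariants: $\mathbf{Q}_m(W)=\{(p_w)_{w\in W}\in\prod_{w\in W}\mathbf{k}[V]: p_w\equiv p_{s_\alpha w}\bmod\langle\alpha\rangle^{m_\alpha}\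 \forall\,\alpha\in\mathcal{A},\ w\in W\}$, a subalgebra of $\prod_{w\in W}\mathbf{k}[V]$ with componentwise multiplication; $\mathbf{V}_m(W)=\mathrm{Spec}\,\mathbf{Q}_m(W)$. Write elements of $\prod_{w}\mathbf{k}[V]\cong\mathbf{k}[V]\otimes\mathbf{k}[W]$ as $\sum_w p_w\otimes w$. The diagonal $W$-action is $g\cdot(p\otimes w)=g(p)\otimes gw$; the right $W$-action is $g\cdot(p\otimes w)=p\otimes wg^{-1}$. The two actions commute and both preserve $\mathbf{Q}_m(W)$. $\mathbf{Q}_m(W)^W$ denotes the invariants of the diagonal action, carrying the $W$-action induced by the right action. *)

theory Defs
  imports "HOL-Algebra.Algebra" "HOL-Algebra.Algebraic_Closure_Type"
begin

section \<open>Coxeter systems\<close>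

text \<open>A Coxeter system in the sense of Bourbaki: the generating involutions \<open>S\<close> together with
  the relations \<open>(st)\<^sup>m = 1\<close>, where \<open>m\<close> is the order of \<open>st\<close>, are a presentation of the group.
  Words over \<open>S\<close> are lists. The relator for \<open>s = t\<close> is \<open>ss\<close>, so formal inverses of
  generators are not needed. The order \<open>group.ord\<close> is \<open>0\<close> for elements of infinite order,
  which gives the empty relator.\<close>

definition word_value :: "('w, 'x) monoid_scheme \<Rightarrow> 'w list \<Rightarrow> 'w" where
  "word_value G ws = foldr (\<lambda>a b. a \<otimes>\<^bsub>G\<^esub> b) ws \<one>\<^bsub>G\<^esub>"

inductive coxeter_step ::
  "('w, 'x) monoid_scheme \<Rightarrow> 'w set \<Rightarrow> 'w list \<Rightarrow> 'w list \<Rightarrow> bool" for G S where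
  "\<lbrakk> s \<in> S; t \<in> S \<rbrakk> \<Longrightarrow>
     coxeter_step G S (us @ vs) (us @ concat (replicate (group.ord G (s \<otimes>\<^bsub>G\<^esub> t)) [s, t]) @ vs)"

definition coxeter_system :: "('w, 'x) monoid_scheme \<Rightarrow> 'w set \<Rightarrow> bool" where
  "coxeter_system G S \<longleftrightarrow>
     group G \<and> S \<subseteq> carrier G \<and>
     (\<forall>s\<in>S. s \<noteq> \<one>\<^bsub>G\<^esub> \<and> s \<otimes>\<^bsub>G\<^esub> s = \<one>\<^bsub>G\<^esub>) \<and>
     generate G S = carrier G \<and>
     (\<forall>ws\<in>lists S. word_value G ws = \<one>\<^bsub>G\<^esub> \<longrightarrow> equivclp (coxeter_step G S) ws [])"


section \<open>Reflection representations\<close>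

definition is_reflection :: "('k::field \<Rightarrow> 'v::ab_group_add \<Rightarrow> 'v) \<Rightarrow> ('v \<Rightarrow> 'v) \<Rightarrow> bool" where
  "is_reflection scale r \<longleftrightarrow>
     Vector_Spaces.linear scale scale r \<and> r \<circ> r = id \<and>
     vector_space.dim scale {x. r x = x} + 1 = vector_space.dim scale UNIV"

text \<open>The representation is required to be faithful. This makes the reflection in \<open>W\<close> with a
  given hyperplane unique.\<close>

definition reflection_representation ::
  "('k::field \<Rightarrow> 'v::ab_group_add \<Rightarrow> 'v) \<Rightarrow> ('w, 'x) monoid_scheme \<Rightarrow> 'w set \<Rightarrow> ('w \<Rightarrow> 'v \<Rightarrow> 'v) \<Rightarrow> bool"
  where
  "reflection_representation scale W S \<rho> \<longleftrightarrow>
     (\<forall>g\<in>carrier W. Vector_Spaces.linear scale scale (\<rho> g)) \<and>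
     \<rho> \<one>\<^bsub>W\<^esub> = id \<and>
     (\<forall>g\<in>carrier W. \<forall>h\<in>carrier W. \<rho> (g \<otimes>\<^bsub>W\<^esub> h) = \<rho> g \<circ> \<rho> h) \<and>
     inj_on \<rho> (carrier W) \<and>
     (\<forall>s\<in>S. is_reflection scale (\<rho> s))"

definition fixed_space :: "('w \<Rightarrow> 'v \<Rightarrow> 'v) \<Rightarrow> 'w \<Rightarrow> 'v set" where
  "fixed_space \<rho> g = {x. \<rho> g x = x}"

definition reflections ::
  "('k::field \<Rightarrow> 'v::ab_group_add \<Rightarrow> 'v) \<Rightarrow> ('w, 'x) monoid_scheme \<Rightarrow> ('w \<Rightarrow> 'v \<Rightarrow> 'v) \<Rightarrow> 'w set" where
  "reflections scale W \<rho> = {g \<in> carrier W. is_reflection scale (\<rho> g)}"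

definition hyperplanes ::
  "('k::field \<Rightarrow> 'v::ab_group_add \<Rightarrow> 'v) \<Rightarrow> ('w, 'x) monoid_scheme \<Rightarrow> ('w \<Rightarrow> 'v \<Rightarrow> 'v) \<Rightarrow> 'v set set" where
  "hyperplanes scale W \<rho> = fixed_space \<rho> ` reflections scale W \<rho>"

definition reflection_at ::
  "('k::field \<Rightarrow> 'v::ab_group_add \<Rightarrow> 'v) \<Rightarrow> ('w, 'x) monoid_scheme \<Rightarrow> ('w \<Rightarrow> 'v \<Rightarrow> 'v) \<Rightarrow> 'v set \<Rightarrow> 'w"
  where
  "reflection_at scale W \<rho> H = (THE s. s \<in> reflections scale W \<rho> \<and> fixed_space \<rho> s = H)"

text \<open>A choice of a linear form \<open>\<alpha> H\<close> with kernel \<open>H\<close> for every reflection hyperplane \<open>H\<close>.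
  The elements of the arrangement are then indexed by the hyperplanes themselves.\<close>

definition defining_forms ::
  "('k::field \<Rightarrow> 'v::ab_group_add \<Rightarrow> 'v) \<Rightarrow> ('w, 'x) monoid_scheme \<Rightarrow> ('w \<Rightarrow> 'v \<Rightarrow> 'v)
    \<Rightarrow> ('v set \<Rightarrow> 'v \<Rightarrow> 'k) \<Rightarrow> bool"
  where
  "defining_forms scale W \<rho> \<alpha> \<longleftrightarrow>
     (\<forall>H\<in>hyperplanes scale W \<rho>. Vector_Spaces.linear scale (*) (\<alpha> H) \<and> {x. \<alpha> H x = 0} = H)"

text \<open>Only the values of a multiplicity function on reflection hyperplanes are relevant.\<close>

definition multiplicities ::
  "('k::field \<Rightarrow> 'v::ab_group_add \<Rightarrow> 'v) \<Rightarrow> ('w, 'x) monoid_scheme \<Rightarrow> ('w \<Rightarrow> 'v \<Rightarrow> 'v)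
    \<Rightarrow> ('v set \<Rightarrow> nat) set"
  where
  "multiplicities scale W \<rho> =
     {m. \<forall>w\<in>carrier W. \<forall>H\<in>hyperplanes scale W \<rho>. m (\<rho> w ` H) = m H}"


section \<open>Polynomial functions\<close>

text \<open>Over an infinite field the symmetric algebra of the dual space is the algebra of functions
  generated by the linear forms.\<close>

inductive_set poly_funs :: "('k::field \<Rightarrow> 'v::ab_group_add \<Rightarrow> 'v) \<Rightarrow> ('v \<Rightarrow> 'k) set"
  for scale :: "'k \<Rightarrow> 'v \<Rightarrow> 'v" where
  const: "(\<lambda>x. c) \<in> poly_funs scale"
| form: "Vector_Spaces.linear scale (*) l \<Longrightarrow> l \<in> poly_funs scale"
| add: "\<lbrakk> p \<in> poly_funs scale; q \<in> poly_funs scale \<rbrakk> \<Longrightarrow> (\<lambda>x. p x + q x) \<in> poly_funs scale"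
| mult: "\<lbrakk> p \<in> poly_funs scale; q \<in> poly_funs scale \<rbrakk> \<Longrightarrow> (\<lambda>x. p x * q x) \<in> poly_funs scale"

definition coordinate_ring ::
  "('k::field \<Rightarrow> 'v::ab_group_add \<Rightarrow> 'v) \<Rightarrow> ('k, 'v \<Rightarrow> 'k) module" where
  "coordinate_ring scale =
     \<lparr> carrier = poly_funs scale,
       monoid.mult = (\<lambda>p q x. p x * q x), one = (\<lambda>x. 1),
       ring.zero = (\<lambda>x. 0), add = (\<lambda>p q x. p x + q x),
       module.smult = (\<lambda>c p x. c * p x) \<rparr>"

definition poly_action ::
  "('w, 'x) monoid_scheme \<Rightarrow> ('w \<Rightarrow> 'v \<Rightarrow> 'v) \<Rightarrow> 'w \<Rightarrow> ('v \<Rightarrow> 'k) \<Rightarrow> ('v \<Rightarrow> 'k)" where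
  "poly_action W \<rho> g p = (\<lambda>x. p (\<rho> (inv\<^bsub>W\<^esub> g) x))"

definition cong_mod_power ::
  "('a, 'x) ring_scheme \<Rightarrow> 'a \<Rightarrow> nat \<Rightarrow> 'a \<Rightarrow> 'a \<Rightarrow> bool" where
  "cong_mod_power R a n p q \<longleftrightarrow> p \<ominus>\<^bsub>R\<^esub> q \<in> (PIdl\<^bsub>R\<^esub> a) [^]\<^bsub>ideals_set R\<^esub> n"


section \<open>Quasi-invariants and quasi-covariants\<close>

definition quasi_invariants ::
  "('k::field \<Rightarrow> 'v::ab_group_add \<Rightarrow> 'v) \<Rightarrow> ('w, 'x) monoid_scheme \<Rightarrow> ('w \<Rightarrow> 'v \<Rightarrow> 'v)
    \<Rightarrow> ('v set \<Rightarrow> 'v \<Rightarrow> 'k) \<Rightarrow> ('v set \<Rightarrow> nat) \<Rightarrow> ('v \<Rightarrow> 'k) set"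
  where
  "quasi_invariants scale W \<rho> \<alpha> k =
     {p \<in> carrier (coordinate_ring scale).
        \<forall>H\<in>hyperplanes scale W \<rho>.
          cong_mod_power (coordinate_ring scale) (\<alpha> H) (2 * k H)
            (poly_action W \<rho> (reflection_at scale W \<rho> H) p) p}"

definition quasi_invariant_algebra ::
  "('k::field \<Rightarrow> 'v::ab_group_add \<Rightarrow> 'v) \<Rightarrow> ('w, 'x) monoid_scheme \<Rightarrow> ('w \<Rightarrow> 'v \<Rightarrow> 'v)
    \<Rightarrow> ('v set \<Rightarrow> 'v \<Rightarrow> 'k) \<Rightarrow> ('v set \<Rightarrow> nat) \<Rightarrow> ('k, 'v \<Rightarrow> 'k) module"
  where
  "quasi_invariant_algebra scale W \<rho> \<alpha> k =
     (coordinate_ring scale)\<lparr>carrier := quasi_invariants scale W \<rho> \<alpha> k\<rparr>"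

definition product_algebra ::
  "('k::field \<Rightarrow> 'v::ab_group_add \<Rightarrow> 'v) \<Rightarrow> ('w, 'x) monoid_scheme \<Rightarrow> ('k, 'w \<Rightarrow> 'v \<Rightarrow> 'k) module"
  where
  "product_algebra scale W =
     (let P = coordinate_ring scale in
      \<lparr> carrier = carrier W \<rightarrow>\<^sub>E carrier P,
        monoid.mult = (\<lambda>p q. \<lambda>w\<in>carrier W. p w \<otimes>\<^bsub>P\<^esub> q w), one = (\<lambda>w\<in>carrier W. \<one>\<^bsub>P\<^esub>),
        ring.zero = (\<lambda>w\<in>carrier W. \<zero>\<^bsub>P\<^esub>), add = (\<lambda>p q. \<lambda>w\<in>carrier W. p w \<oplus>\<^bsub>P\<^esub> q w),
        module.smult = (\<lambda>c p. \<lambda>w\<in>carrier W. c \<odot>\<^bsub>P\<^esub> p w) \<rparr>)"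

definition quasi_covariants ::
  "('k::field \<Rightarrow> 'v::ab_group_add \<Rightarrow> 'v) \<Rightarrow> ('w, 'x) monoid_scheme \<Rightarrow> ('w \<Rightarrow> 'v \<Rightarrow> 'v)
    \<Rightarrow> ('v set \<Rightarrow> 'v \<Rightarrow> 'k) \<Rightarrow> ('v set \<Rightarrow> nat) \<Rightarrow> ('w \<Rightarrow> 'v \<Rightarrow> 'k) set"
  where
  "quasi_covariants scale W \<rho> \<alpha> m =
     {p \<in> carrier (product_algebra scale W).
        \<forall>H\<in>hyperplanes scale W \<rho>. \<forall>w\<in>carrier W.
          cong_mod_power (coordinate_ring scale) (\<alpha> H) (m H)
            (p w) (p (reflection_at scale W \<rho> H \<otimes>\<^bsub>W\<^esub> w))}"

text \<open>Writing a family \<open>p\<close> as \<open>\<Sum>w. p w \<otimes> w\<close>, the diagonal action is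
  \<open>g \<cdot> (p \<otimes> w) = g(p) \<otimes> gw\<close> and the right action is \<open>g \<cdot> (p \<otimes> w) = p \<otimes> wg\<^sup>-\<^sup>1\<close>.
  The component of \<open>g \<cdot> p\<close> at \<open>w\<close> therefore comes from the component of \<open>p\<close> at \<open>g\<^sup>-\<^sup>1w\<close>,
  respectively at \<open>wg\<close>.\<close>

definition diagonal_action ::
  "('w, 'x) monoid_scheme \<Rightarrow> ('w \<Rightarrow> 'v \<Rightarrow> 'v) \<Rightarrow> 'w \<Rightarrow> ('w \<Rightarrow> 'v \<Rightarrow> 'k) \<Rightarrow> ('w \<Rightarrow> 'v \<Rightarrow> 'k)" where
  "diagonal_action W \<rho> g p = (\<lambda>w\<in>carrier W. poly_action W \<rho> g (p (inv\<^bsub>W\<^esub> g \<otimes>\<^bsub>W\<^esub> w)))"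

definition right_action ::
  "('w, 'x) monoid_scheme \<Rightarrow> 'w \<Rightarrow> ('w \<Rightarrow> 'a) \<Rightarrow> ('w \<Rightarrow> 'a)" where
  "right_action W g p = (\<lambda>w\<in>carrier W. p (w \<otimes>\<^bsub>W\<^esub> g))"

definition diagonal_invariant_algebra ::
  "('k::field \<Rightarrow> 'v::ab_group_add \<Rightarrow> 'v) \<Rightarrow> ('w, 'x) monoid_scheme \<Rightarrow> ('w \<Rightarrow> 'v \<Rightarrow> 'v)
    \<Rightarrow> ('v set \<Rightarrow> 'v \<Rightarrow> 'k) \<Rightarrow> ('v set \<Rightarrow> nat) \<Rightarrow> ('k, 'w \<Rightarrow> 'v \<Rightarrow> 'k) module"
  where
  "diagonal_invariant_algebra scale W \<rho> \<alpha> m =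
     (product_algebra scale W)
       \<lparr>carrier := {p \<in> quasi_covariants scale W \<rho> \<alpha> m. \<forall>g\<in>carrier W. diagonal_action W \<rho> g p = p}\<rparr>"


section \<open>Algebras with a group action\<close>

definition group_algebra_action ::
  "('k, 'y) ring_scheme \<Rightarrow> ('w, 'x) monoid_scheme \<Rightarrow> ('k, 'a, 'z) module_scheme
    \<Rightarrow> ('w \<Rightarrow> 'a \<Rightarrow> 'a) \<Rightarrow> bool"
  where
  "group_algebra_action K G A act \<longleftrightarrow>
     algebra K A \<and>
     group_action G (carrier A) (\<lambda>g. restrict (act g) (carrier A)) \<and>
     (\<forall>g\<in>carrier G. act g \<in> ring_hom A A \<and>
        (\<forall>c\<in>carrier K. \<forall>a\<in>carrier A. act g (c \<odot>\<^bsub>A\<^esub> a) = c \<odot>\<^bsub>A\<^esub> act g a))"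

definition equivariant_algebra_isos ::
  "('k, 'y) ring_scheme \<Rightarrow> ('w, 'x) monoid_scheme
    \<Rightarrow> ('k, 'a, 'z) module_scheme \<Rightarrow> ('w \<Rightarrow> 'a \<Rightarrow> 'a)
    \<Rightarrow> ('k, 'b, 'u) module_scheme \<Rightarrow> ('w \<Rightarrow> 'b \<Rightarrow> 'b) \<Rightarrow> ('a \<Rightarrow> 'b) set"
  where
  "equivariant_algebra_isos K G A act B act' =
     {\<phi> \<in> ring_iso A B.
        (\<forall>c\<in>carrier K. \<forall>a\<in>carrier A. \<phi> (c \<odot>\<^bsub>A\<^esub> a) = c \<odot>\<^bsub>B\<^esub> \<phi> a) \<and>
        (\<forall>g\<in>carrier G. \<forall>a\<in>carrier A. \<phi> (act g a) = act' g (\<phi> a))}"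

end

theory Submission
  imports Defs
begin

text \<open>A family \<open>p\<close> is invariant under the diagonal action exactly when \<open>p w = w(p 1)\<close> for all \<open>w\<close>, so
  evaluation at the identity is injective on invariants and carries the right action to the action
  on functions. Conjugating by \<open>w\<close> turns the congruence for \<open>p\<close> at \<open>(H, w)\<close> into the one for
  \<open>f = p 1\<close> at \<open>w\<^sup>-\<^sup>1H\<close>, so by invariance of \<open>m\<close> the condition on \<open>p\<close> is that \<open>\<alpha>\<^sup>m\<close>
  divides \<open>s f - f\<close> for every reflection \<open>s\<close>. Since \<open>s f - f\<close> is anti-invariant under \<open>s\<close>,
  its order along the hyperplane is odd or infinite, hence \<open>m\<close> may be replaced by
  \<open>2 * (m div 2)\<close>.\<close>

section \<open>Ideal powers, subalgebras and actions\<close>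

text \<open>Products of generators satisfy (u a)(v b) = (u v)(a b), and a principal ideal absorbs
  their sums; conversely u (a b) = (u a)(1 b) is a single such product.\<close>

lemma (in cring) ideal_prod_cgenideal:
  assumes a: "a \<in> carrier R" and b: "b \<in> carrier R"
  shows "(PIdl a) \<cdot> (PIdl b) = PIdl (a \<otimes> b)"
proof (intro equalityI subsetI)
  fix x assume "x \<in> (PIdl a) \<cdot> (PIdl b)"
  then show "x \<in> PIdl (a \<otimes> b)"
  proof induction
    case (prod i j)
    then obtain u v where uv: "u \<in> carrier R" "v \<in> carrier R" "i = u \<otimes> a" "j = v \<otimes> b"
      by (auto simp: cgenideal_def)
    then have "i \<otimes> j = (u \<otimes> v) \<otimes> (a \<otimes> b)"
      using a b by (simp add: m_ac)
    with uv show ?case by (auto simp: cgenideal_def)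
  next
    case (sum s t)
    then show ?case
      using cgenideal_ideal[of "a \<otimes> b"] a b
      by (simp add: additive_subgroup.a_closed ideal.axioms(1))
  qed
next
  fix x assume "x \<in> PIdl (a \<otimes> b)"
  then obtain u where u: "u \<in> carrier R" "x = u \<otimes> (a \<otimes> b)"
    by (auto simp: cgenideal_def)
  then have "x = (u \<otimes> a) \<otimes> (\<one> \<otimes> b)"
    using a b by (simp add: m_assoc)
  moreover have "u \<otimes> a \<in> PIdl a" "\<one> \<otimes> b \<in> PIdl b"
    using u by (auto simp: cgenideal_def)
  ultimately show "x \<in> (PIdl a) \<cdot> (PIdl b)"
    using ideal_prod.prod by metis
qed

text \<open>Turns the power in the monoid of ideals, used by \<open>cong_mod_power\<close>, into
  divisibility by \<open>a [^] n\<close>. Exponent 0 gives the unit ideal, generated by 1.\<close>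

lemma (in cring) cgenideal_pow:
  assumes a: "a \<in> carrier R"
  shows "(PIdl a) [^]\<^bsub>ideals_set R\<^esub> (n::nat) = PIdl (a [^] n)"
proof -
  interpret I: comm_monoid "ideals_set R" by (rule ideals_set_is_comm_monoid)
  show ?thesis
  proof (induction n)
    case 0
    then show ?case by (simp add: ideals_set_def) (force simp: cgenideal_def)
  next
    case (Suc n)
    then show ?case using a by (simp add: ideals_set_def ideal_prod_cgenideal)
  qed
qed

lemma (in cring) cong_mod_power_iff:
  assumes "a \<in> carrier R"
  shows "cong_mod_power R a n p q \<longleftrightarrow> (\<exists>r\<in>carrier R. p \<ominus> q = r \<otimes> a [^] n)"
  unfolding cong_mod_power_def cgenideal_pow[OF assms] by (auto simp: cgenideal_def)

text \<open>Additive inverses are scalar multiples by -1, so closure under scalars provides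
  them.\<close>

lemma (in algebra) subalgebra_algebra:
  assumes sub: "H \<subseteq> carrier M" and one: "\<one>\<^bsub>M\<^esub> \<in> H"
    and mult: "\<And>x y. \<lbrakk> x \<in> H; y \<in> H \<rbrakk> \<Longrightarrow> x \<otimes>\<^bsub>M\<^esub> y \<in> H"
    and add: "\<And>x y. \<lbrakk> x \<in> H; y \<in> H \<rbrakk> \<Longrightarrow> x \<oplus>\<^bsub>M\<^esub> y \<in> H"
    and smult: "\<And>c x. \<lbrakk> c \<in> carrier R; x \<in> H \<rbrakk> \<Longrightarrow> c \<odot>\<^bsub>M\<^esub> x \<in> H"
  shows "algebra R (M\<lparr>carrier := H\<rparr>)"
proof -
  have ring: "ring M" and cring: "cring M"
    using M_cring by (auto dest: cring.axioms)
  have "\<ominus>\<^bsub>M\<^esub> x \<in> H" if "x \<in> H" for x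
  proof -
    have "\<ominus>\<^bsub>M\<^esub> x = (\<ominus> \<one>) \<odot>\<^bsub>M\<^esub> x"
      using that sub by (subst smult_l_minus) auto
    then show ?thesis using that smult by simp
  qed
  then have "subring H M"
    using sub one mult add by (intro ring.subringI[OF ring]) auto
  then have "cring (M\<lparr>carrier := H\<rparr>)"
    using cring.subcringI'[OF cring] ring.subcring_iff[OF ring] sub by blast
  then show ?thesis
    using sub smult
    by (intro algebraI)
      (auto simp: R.is_cring subset_iff smult_l_distr smult_r_distr smult_assoc1 smult_assoc2)
qed

text \<open>Bijectivity of \<open>act g\<close> comes from the inverse map
  \<open>act (inv g)\<close>. The maps are restricted because elements of \<open>Bij E\<close> are
  extensional.\<close>

lemma group_actionI:
  assumes G: "group G"
    and closed: "\<And>g x. \<lbrakk> g \<in> carrier G; x \<in> E \<rbrakk> \<Longrightarrow> act g x \<in> E"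
    and one: "\<And>x. x \<in> E \<Longrightarrow> act \<one>\<^bsub>G\<^esub> x = x"
    and mult: "\<And>g h x. \<lbrakk> g \<in> carrier G; h \<in> carrier G; x \<in> E \<rbrakk> \<Longrightarrow>
      act (g \<otimes>\<^bsub>G\<^esub> h) x = act g (act h x)"
  shows "group_action G E (\<lambda>g. restrict (act g) E)"
proof -
  interpret G: group G by (rule G)
  have bij: "restrict (act g) E \<in> Bij E" if g: "g \<in> carrier G" for g
  proof -
    have "act g (act (inv\<^bsub>G\<^esub> g) x) = x" "act (inv\<^bsub>G\<^esub> g) (act g x) = x" if "x \<in> E" for x
      using g that mult[of g "inv\<^bsub>G\<^esub> g" x] mult[of "inv\<^bsub>G\<^esub> g" g x] one by auto
    then have "bij_betw (act g) E E"
      using closed g by (intro bij_betwI[where g = "act (inv\<^bsub>G\<^esub> g)"]) auto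
    then show ?thesis
      by (simp add: Bij_def bij_betw_restrict_eq)
  qed
  have "(\<lambda>g. restrict (act g) E) \<in> hom G (BijGroup E)"
    using bij closed mult by (auto simp: hom_def BijGroup_def compose_def fun_eq_iff)
  then show ?thesis
    unfolding group_action_def group_hom_def group_hom_axioms_def
    using G group_BijGroup by blast
qed

section \<open>Polynomial functions\<close>

lemma poly_funs_uminus: "p \<in> poly_funs scale \<Longrightarrow> (\<lambda>x. - p x) \<in> poly_funs scale"
  using poly_funs.mult[OF poly_funs.const[of "-1" scale]] by fastforce

lemma poly_funs_smult: "p \<in> poly_funs scale \<Longrightarrow> (\<lambda>x. c * p x) \<in> poly_funs scale"
  by (rule poly_funs.mult[OF poly_funs.const])

lemma poly_funs_linear_comp:
  assumes "p \<in> poly_funs scale" and g: "Vector_Spaces.linear scale scale g"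
  shows "(\<lambda>x. p (g x)) \<in> poly_funs scale"
  using assms(1)
proof induction
  case (form l)
  from Vector_Spaces.linear_compose[OF g form] show ?case
    by (simp add: poly_funs.form comp_def)
qed (auto intro: poly_funs.intros)

text \<open>The cofactor is a divided difference, built along the generation of \<open>p\<close>: 0
  for a constant, -l(d) for a form l, and a twisted Leibniz rule for products. It is polynomial by
  construction, so no division of functions occurs.\<close>

lemma poly_funs_shift_dvd:
  assumes "p \<in> poly_funs scale" and a: "Vector_Spaces.linear scale (*) a"
  shows "\<exists>q\<in>poly_funs scale. \<forall>x. p x - p (x + scale (a x) d) = a x * q x"
proof -
  interpret a: Vector_Spaces.linear scale "(*)" a by (rule a)
  have g: "Vector_Spaces.linear scale scale (\<lambda>x. x + scale (a x) d)"
    by unfold_locales (auto simp: a.add a.scale a.vs1.scale_left_distrib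
        a.vs1.scale_right_distrib)
  show ?thesis
    using assms(1)
  proof induction
    case (const c)
    show ?case by (rule bexI[OF _ poly_funs.const[of 0]]) simp
  next
    case (form l)
    then interpret l: Vector_Spaces.linear scale "(*)" l .
    show ?case
      by (rule bexI[OF _ poly_funs.const[of "- l d"]]) (simp add: l.add l.scale)
  next
    case (add p q)
    then obtain u v where "u \<in> poly_funs scale" "\<forall>x. p x - p (x + scale (a x) d) = a x * u x"
      "v \<in> poly_funs scale" "\<forall>x. q x - q (x + scale (a x) d) = a x * v x"
      by blast
    then show ?case
      by (intro bexI[OF _ poly_funs.add[of u _ v]]) (simp_all add: add_diff_add distrib_left)
  next
    case (mult p q)
    then obtain u v where u: "u \<in> poly_funs scale" "\<forall>x. p x - p (x + scale (a x) d) = a x * u x"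
      and v: "v \<in> poly_funs scale" "\<forall>x. q x - q (x + scale (a x) d) = a x * v x"
      by blast
    \<comment> \<open>Twisted Leibniz rule, obtained by inserting p x * q y; the point y stands for
      the shifted argument.\<close>
    have "p x * q x - p y * q y = a x * (p x * v x + u x * q y)"
      if "p x - p y = a x * u x" "q x - q y = a x * v x" for x y
    proof -
      have "p x * q x - p y * q y = p x * (q x - q y) + (p x - p y) * q y"
        by (simp add: algebra_simps)
      also have "\<dots> = a x * (p x * v x + u x * q y)"
        unfolding that by (simp only: distrib_left mult_ac)
      finally show ?thesis .
    qed
    then have "\<forall>x. p x * q x - p (x + scale (a x) d) * q (x + scale (a x) d) =
        a x * (p x * v x + u x * q (x + scale (a x) d))"
      using u(2) v(2) by blast
    moreover have "(\<lambda>x. p x * v x + u x * q (x + scale (a x) d)) \<in> poly_funs scale"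
      using mult u v by (intro poly_funs.add poly_funs.mult poly_funs_linear_comp[OF _ g])
    ultimately show ?case by (rule rev_bexI[rotated])
  qed
qed

lemma coordinate_ring_simps [simp]:
  "carrier (coordinate_ring scale) = poly_funs scale"
  "p \<otimes>\<^bsub>coordinate_ring scale\<^esub> q = (\<lambda>x. p x * q x)"
  "\<one>\<^bsub>coordinate_ring scale\<^esub> = (\<lambda>x. 1)"
  "\<zero>\<^bsub>coordinate_ring scale\<^esub> = (\<lambda>x. 0)"
  "p \<oplus>\<^bsub>coordinate_ring scale\<^esub> q = (\<lambda>x. p x + q x)"
  "c \<odot>\<^bsub>coordinate_ring scale\<^esub> p = (\<lambda>x. c * p x)"
  by (simp_all add: coordinate_ring_def)

lemma product_algebra_simps [simp]:
  "carrier (product_algebra scale W) = carrier W \<rightarrow>\<^sub>E poly_funs scale"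
  "p \<otimes>\<^bsub>product_algebra scale W\<^esub> q = (\<lambda>w\<in>carrier W. \<lambda>x. p w x * q w x)"
  "\<one>\<^bsub>product_algebra scale W\<^esub> = (\<lambda>w\<in>carrier W. \<lambda>x. 1)"
  "\<zero>\<^bsub>product_algebra scale W\<^esub> = (\<lambda>w\<in>carrier W. \<lambda>x. 0)"
  "p \<oplus>\<^bsub>product_algebra scale W\<^esub> q = (\<lambda>w\<in>carrier W. \<lambda>x. p w x + q w x)"
  "c \<odot>\<^bsub>product_algebra scale W\<^esub> p = (\<lambda>w\<in>carrier W. \<lambda>x. c * p w x)"
  by (simp_all add: product_algebra_def Let_def)

lemma algebra_coordinate_ring: "algebra ring_of_type_algebra (coordinate_ring scale)"
proof (rule algebraI[OF cring_from_type_algebra])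
  show "cring (coordinate_ring scale)"
  proof (intro cringI abelian_groupI comm_monoidI)
    fix p assume "p \<in> carrier (coordinate_ring scale)"
    then show "\<exists>q\<in>carrier (coordinate_ring scale).
        q \<oplus>\<^bsub>coordinate_ring scale\<^esub> p = \<zero>\<^bsub>coordinate_ring scale\<^esub>"
      by (intro bexI[of _ "\<lambda>x. - p x"]) (auto intro: poly_funs_uminus)
  qed (auto intro: poly_funs.intros simp: algebra_simps)
qed (auto intro: poly_funs_smult simp: algebra_simps ring_of_type_algebra_def)

lemma algebra_product_algebra: "algebra ring_of_type_algebra (product_algebra scale W)"
proof (rule algebraI[OF cring_from_type_algebra])
  show "cring (product_algebra scale W)"
  proof (intro cringI abelian_groupI comm_monoidI)
    fix p assume "p \<in> carrier (product_algebra scale W)"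
    then show "\<exists>q\<in>carrier (product_algebra scale W).
        q \<oplus>\<^bsub>product_algebra scale W\<^esub> p = \<zero>\<^bsub>product_algebra scale W\<^esub>"
      by (intro bexI[of _ "\<lambda>w\<in>carrier W. \<lambda>x. - p w x"])
        (auto intro!: poly_funs_uminus restrict_ext simp: PiE_iff)
  qed (auto intro!: poly_funs.add poly_funs.mult poly_funs.const
        simp: PiE_iff fun_eq_iff extensional_def algebra_simps)
qed (auto intro!: poly_funs_smult
      simp: PiE_iff fun_eq_iff extensional_def algebra_simps ring_of_type_algebra_def)

text \<open>Replaces ideal congruences by pointwise identities with a polynomial cofactor, the form
  in which all later arguments run.\<close>

lemma cong_mod_power_coordinate_ring_iff:
  assumes "a \<in> poly_funs scale" "q \<in> poly_funs scale"
  shows "cong_mod_power (coordinate_ring scale) a n p q \<longleftrightarrow>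
    (\<exists>r\<in>poly_funs scale. \<forall>x. p x - q x = a x ^ n * r x)"
proof -
  interpret P: algebra ring_of_type_algebra "coordinate_ring scale"
    by (rule algebra_coordinate_ring)
  interpret P: cring "coordinate_ring scale"
    by (rule P.M_cring)
  \<comment> \<open>Negation in the ring is defined by a description, so it is identified through
    uniqueness of additive inverses.\<close>
  have "\<ominus>\<^bsub>coordinate_ring scale\<^esub> q = (\<lambda>x. - q x)"
    using assms by (intro P.minus_equality) (auto intro: poly_funs_uminus)
  then have "p \<ominus>\<^bsub>coordinate_ring scale\<^esub> q = (\<lambda>x. p x - q x)"
    by (simp add: a_minus_def)
  moreover have "a [^]\<^bsub>coordinate_ring scale\<^esub> n = (\<lambda>x. a x ^ n)"
    by (induction n) (auto simp: mult.commute)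
  ultimately show ?thesis
    using P.cong_mod_power_iff[of a n p q] assms by (auto simp: fun_eq_iff mult.commute)
qed

section \<open>Reflections\<close>

text \<open>The dimension condition excludes r = id, so some v has a v = 1. Then x - a(x) v lies in
  the kernel and is fixed, which forces d = r v - v.\<close>

lemma is_reflection_formula:
  assumes r: "is_reflection scale r" and a: "Vector_Spaces.linear scale (*) a"
    and ker: "{x. a x = 0} = {x. r x = x}"
  obtains d where "\<And>x. r x = x + scale (a x) d" "a d = -2"
proof -
  interpret a: Vector_Spaces.linear scale "(*)" a by (rule a)
  interpret r: Vector_Spaces.linear scale scale r
    using r by (simp add: is_reflection_def)
  have "{x. r x = x} \<noteq> UNIV"
    using r by (auto simp: is_reflection_def)
  then obtain u where u: "a u \<noteq> 0"
    using ker by auto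
  define v where "v = scale (1 / a u) u"
  have v: "a v = 1"
    using u by (simp add: v_def a.scale)
  define d where "d = r v - v"
  have formula: "r x = x + scale (a x) d" for x
  proof -
    have "a (x - scale (a x) v) = 0"
      using v by (simp add: a.diff a.scale)
    then have "r (x - scale (a x) v) = x - scale (a x) v"
      using ker by blast
    then show ?thesis
      by (simp add: r.diff r.scale d_def a.vs1.scale_right_diff_distrib algebra_simps)
  qed
  have "r (r v) = v"
    using r by (simp add: is_reflection_def fun_eq_iff)
  \<comment> \<open>Applying the formula twice moves v by a v + a (r v) times d, which must vanish
    for an involution.\<close>
  then have "scale (a v + a (r v)) d = 0"
    using formula[of v] formula[of "r v"] by (simp add: a.vs1.scale_left_distrib)
  \<comment> \<open>Otherwise v would be fixed, hence in the kernel, against a v = 1.\<close>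
  moreover have "d \<noteq> 0"
    using ker v by (auto simp: d_def set_eq_iff dest: spec[of _ v])
  ultimately have "a v + a (r v) = 0"
    by simp
  then have "a d = -2"
    using v by (simp add: d_def a.diff)
  with formula show thesis by (rule that)
qed

text \<open>If b v is nonzero, subtracting b x / b v times v from x lands in the common kernel, so
  the constant is a v / b v. If b = 0 then a = 0 as well.\<close>

lemma linear_forms_same_kernel:
  assumes a: "Vector_Spaces.linear scale (*) a" and b: "Vector_Spaces.linear scale (*) b"
    and ker: "\<And>x. a x = 0 \<longleftrightarrow> b x = 0"
  obtains c where "\<And>x. a x = c * b x"
proof (cases "\<exists>v. b v \<noteq> 0")
  case True
  then obtain v where v: "b v \<noteq> 0" by blast
  interpret a: Vector_Spaces.linear scale "(*)" a by (rule a)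
  interpret b: Vector_Spaces.linear scale "(*)" b by (rule b)
  have "a x = a v / b v * b x" for x
  proof -
    have "b (x - scale (b x / b v) v) = 0"
      using v by (simp add: b.diff b.scale)
    then have "a (x - scale (b x / b v) v) = 0"
      using ker by blast
    then show ?thesis by (simp add: a.diff a.scale)
  qed
  then show thesis by (rule that)
next
  case False
  then show thesis using that[of 0] ker by simp
qed

text \<open>A power of a linear form dividing \<open>f \<circ> r - f\<close> can be taken odd: \<open>f \<circ> r - f\<close> is
  anti-invariant under \<open>r\<close>, so its cofactor at an even power may be replaced by its
  anti-invariant part, which vanishes on the hyperplane.\<close>

lemma anti_invariant_dvd_odd_power:
  fixes scale :: "'k::field_char_0 \<Rightarrow> 'v::ab_group_add \<Rightarrow> 'v"
  assumes a: "Vector_Spaces.linear scale (*) a"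
    and r: "\<And>x. r x = x + scale (a x) d" and d: "a d = -2"
    and n: "even n" and q: "q \<in> poly_funs scale"
    and eq: "\<And>x. f (r x) - f x = a x ^ n * q x"
  shows "\<exists>q'\<in>poly_funs scale. \<forall>x. f (r x) - f x = a x ^ Suc n * q' x"
proof -
  interpret a: Vector_Spaces.linear scale "(*)" a by (rule a)
  have ar: "a (r x) = - a x" for x
    by (simp add: r a.add a.scale d)
  have rr: "r (r x) = x" for x
    using ar[of x] r[of x] r[of "r x"] by simp
  obtain u where u: "u \<in> poly_funs scale" "\<And>x. q x - q (r x) = a x * u x"
    using poly_funs_shift_dvd[OF q a, of d] r by auto
  have "f (r x) - f x = a x ^ Suc n * (1 / 2 * u x)" for x
  proof -
    \<comment> \<open>At the point r x the factor a^n is unchanged because n is even, while the left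
      side changes sign. The factor \<open>a x ^ n\<close> is kept rather than cancelled, since a x
      may vanish.\<close>
    have "a x ^ n * q (r x) = f x - f (r x)"
      using eq[of "r x"] n by (simp add: ar rr)
    also have "\<dots> = - (a x ^ n * q x)"
      unfolding eq[symmetric] by simp
    finally have "2 * (a x ^ n * q x) = a x ^ n * (q x - q (r x))"
      by (simp add: right_diff_distrib)
    also have "\<dots> = a x ^ n * (a x * u x)"
      by (simp only: u(2))
    finally have twice: "2 * (a x ^ n * q x) = a x ^ n * (a x * u x)" .
    have "a x ^ n * q x = 1 / 2 * (2 * (a x ^ n * q x))"
      by simp
    then show ?thesis
      unfolding eq twice by (simp only: power_Suc mult_ac)
  qed
  then show ?thesis
    by (intro bexI[OF _ poly_funs_smult[OF u(1), of "1 / 2"]] allI)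
qed

section \<open>Faithful finite linear groups and their action on reflection hyperplanes\<close>

locale faithful_linear_group =
  finite_dimensional_vector_space scale Basis + W?: group W
  for scale :: "'k::field_char_0 \<Rightarrow> 'v::ab_group_add \<Rightarrow> 'v" and Basis
    and W :: "('w, 'x) monoid_scheme" +
  fixes \<rho> :: "'w \<Rightarrow> 'v \<Rightarrow> 'v" and \<alpha> :: "'v set \<Rightarrow> 'v \<Rightarrow> 'k"
  assumes finite_W: "finite (carrier W)"
    and linear_rho: "g \<in> carrier W \<Longrightarrow> Vector_Spaces.linear scale scale (\<rho> g)"
    and rho_one: "\<rho> \<one>\<^bsub>W\<^esub> = id"
    and rho_mult: "\<lbrakk> g \<in> carrier W; h \<in> carrier W \<rbrakk> \<Longrightarrow> \<rho> (g \<otimes>\<^bsub>W\<^esub> h) = \<rho> g \<circ> \<rho> h"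
    and inj_rho: "inj_on \<rho> (carrier W)"
    and forms: "defining_forms scale W \<rho> \<alpha>"
begin

lemma rho_inv [simp]:
  assumes "g \<in> carrier W"
  shows "\<rho> g (\<rho> (inv\<^bsub>W\<^esub> g) x) = x" "\<rho> (inv\<^bsub>W\<^esub> g) (\<rho> g x) = x"
  using rho_mult[of g "inv\<^bsub>W\<^esub> g"] rho_mult[of "inv\<^bsub>W\<^esub> g" g] assms rho_one
  by (auto simp: fun_eq_iff)

lemma rho_pow: "g \<in> carrier W \<Longrightarrow> \<rho> (g [^]\<^bsub>W\<^esub> (n::nat)) = \<rho> g ^^ n"
  by (induction n) (simp_all add: rho_one rho_mult funpow_Suc_right del: funpow.simps(2))

lemma linear_form:
  "H \<in> hyperplanes scale W \<rho> \<Longrightarrow> Vector_Spaces.linear scale (*) (\<alpha> H)"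
  using forms by (simp add: defining_forms_def)

lemma form_eq_0_iff: "H \<in> hyperplanes scale W \<rho> \<Longrightarrow> \<alpha> H x = 0 \<longleftrightarrow> x \<in> H"
  using forms by (auto simp: defining_forms_def)

text \<open>The product of two reflections in the same hyperplane is a transvection; having finite
  order in characteristic zero, it is trivial.\<close>

lemma reflection_unique:
  assumes s: "s \<in> reflections scale W \<rho>" and t: "t \<in> reflections scale W \<rho>"
    and fixed: "fixed_space \<rho> s = fixed_space \<rho> t"
  shows "s = t"
proof -
  define a where "a = \<alpha> (fixed_space \<rho> s)"
  have H: "fixed_space \<rho> s \<in> hyperplanes scale W \<rho>"
    using s by (simp add: hyperplanes_def)
  interpret a: Vector_Spaces.linear scale "(*)" a
    unfolding a_def by (rule linear_form[OF H])
  have ker: "{x. a x = 0} = {x. \<rho> s x = x}" "{x. a x = 0} = {x. \<rho> t x = x}"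
    using form_eq_0_iff[OF H] fixed by (auto simp: a_def fixed_space_def)
  obtain d where d: "\<And>x. \<rho> s x = x + scale (a x) d" "a d = -2"
    using is_reflection_formula[OF _ a.linear_axioms ker(1)] s by (auto simp: reflections_def)
  obtain e where e: "\<And>x. \<rho> t x = x + scale (a x) e" "a e = -2"
    using is_reflection_formula[OF _ a.linear_axioms ker(2)] t by (auto simp: reflections_def)
  have carr: "s \<in> carrier W" "t \<in> carrier W"
    using s t by (auto simp: reflections_def)
  let ?g = "t \<otimes>\<^bsub>W\<^esub> s"
  have g: "\<rho> ?g x = x + scale (a x) (d - e)" for x
  proof -
    have "\<rho> ?g x = x + scale (a x) d + scale (a x + a x * a d) e"
      using carr by (simp add: rho_mult d(1) e(1) a.add a.scale)
    also have "a x + a x * a d = - a x"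
      by (simp add: d(2))
    finally show ?thesis
      by (simp add: scale_right_diff_distrib)
  qed
  \<comment> \<open>The displacement direction lies in the hyperplane, so the displacements of
    successive powers simply add up.\<close>
  have a_diff: "a (d - e) = 0"
    by (simp add: a.diff d(2) e(2))
  have pow: "(\<rho> ?g ^^ n) x = x + scale (of_nat n * a x) (d - e)" for n x
  proof (induction n)
    case (Suc n)
    have "(\<rho> ?g ^^ Suc n) x = \<rho> ?g (x + scale (of_nat n * a x) (d - e))"
      by (simp only: funpow.simps comp_apply Suc)
    also have "\<dots> = x + scale (of_nat n * a x) (d - e) + scale (a x) (d - e)"
      by (simp only: g a.add a.scale a_diff mult_zero_right add_0_right)
    also have "\<dots> = x + scale (of_nat (Suc n) * a x) (d - e)"
      by (simp only: of_nat_Suc distrib_right scale_left_distrib mult_1 add_ac)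
    finally show ?case .
  qed simp
  have "\<rho> ?g ^^ Coset.order W = \<rho> (?g [^]\<^bsub>W\<^esub> Coset.order W)"
    using carr by (simp add: rho_pow)
  also have "\<dots> = id"
    using carr by (simp add: pow_order_eq_1 rho_one)
  \<comment> \<open>The point d is chosen because a d = -2 is nonzero; in characteristic zero the
    resulting multiple of d - e then vanishes only if d = e.\<close>
  finally have "(\<rho> ?g ^^ Coset.order W) d = d"
    by simp
  then have "scale (of_nat (Coset.order W) * a d) (d - e) = 0"
    unfolding pow by simp
  moreover have "Coset.order W > 0"
    using finite_W by (simp add: order_gt_0_iff_finite)
  ultimately have "d = e"
    using d(2) by simp
  then have "\<rho> s = \<rho> t"
    using d e by (simp add: fun_eq_iff)
  then show ?thesis
    using inj_rho carr by (simp add: inj_on_eq_iff)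
qed

text \<open>Uniqueness makes the description in \<open>reflection_at\<close> well defined.\<close>

lemma reflection_at_eq:
  assumes "s \<in> reflections scale W \<rho>"
  shows "reflection_at scale W \<rho> (fixed_space \<rho> s) = s"
  unfolding reflection_at_def using assms reflection_unique by (intro the_equality) auto

text \<open>The fixed space is carried along by \<open>\<rho> w\<close>, which is injective and
  linear and so preserves its dimension; involutivity and linearity pass to conjugates.\<close>

lemma conj_reflection:
  assumes s: "s \<in> reflections scale W \<rho>" and w: "w \<in> carrier W"
  defines "t \<equiv> w \<otimes>\<^bsub>W\<^esub> s \<otimes>\<^bsub>W\<^esub> inv\<^bsub>W\<^esub> w"
  shows "t \<in> reflections scale W \<rho>" "fixed_space \<rho> t = \<rho> w ` fixed_space \<rho> s"
proof -
  have carr: "s \<in> carrier W" "t \<in> carrier W"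
    using s w by (auto simp: reflections_def t_def)
  have t: "\<rho> t x = \<rho> w (\<rho> s (\<rho> (inv\<^bsub>W\<^esub> w) x))" for x
    using carr w by (simp add: t_def rho_mult)
  show *: "fixed_space \<rho> t = \<rho> w ` fixed_space \<rho> s"
  proof (intro equalityI subsetI)
    fix x assume "x \<in> fixed_space \<rho> t"
    then have "\<rho> w (\<rho> s (\<rho> (inv\<^bsub>W\<^esub> w) x)) = x"
      by (simp add: fixed_space_def t)
    from arg_cong[OF this, of "\<rho> (inv\<^bsub>W\<^esub> w)"]
    have "\<rho> (inv\<^bsub>W\<^esub> w) x \<in> fixed_space \<rho> s"
      using w by (simp add: fixed_space_def)
    then show "x \<in> \<rho> w ` fixed_space \<rho> s"
      using w by (intro image_eqI[where x = "\<rho> (inv\<^bsub>W\<^esub> w) x"]) simp_all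
  qed (auto simp: fixed_space_def t w)
  interpret pair: finite_dimensional_vector_space_pair scale Basis scale Basis ..
  have "inj (\<rho> w)"
    by (rule inj_on_inverseI[where g = "\<rho> (inv\<^bsub>W\<^esub> w)"]) (simp add: w)
  then have "dim (\<rho> w ` fixed_space \<rho> s) = dim (fixed_space \<rho> s)"
    using w by (intro pair.dim_image_eq linear_rho) (auto intro: inj_on_subset)
  moreover have "is_reflection scale (\<rho> s)"
    using s by (simp add: reflections_def)
  ultimately have "is_reflection scale (\<rho> t)"
    using * carr linear_rho w
    by (auto simp: is_reflection_def fun_eq_iff t fixed_space_def)
  with carr show "t \<in> reflections scale W \<rho>"
    by (simp add: reflections_def)
qed

lemma reflection_at:
  assumes "H \<in> hyperplanes scale W \<rho>"
  shows "reflection_at scale W \<rho> H \<in> reflections scale W \<rho>"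
    and "fixed_space \<rho> (reflection_at scale W \<rho> H) = H"
  using assms reflection_at_eq by (auto simp: hyperplanes_def)

lemma reflection_at_closed:
  "H \<in> hyperplanes scale W \<rho> \<Longrightarrow> reflection_at scale W \<rho> H \<in> carrier W"
  using reflection_at(1) by (simp add: reflections_def)

text \<open>The square acts as the identity, and faithfulness brings this back to
  \<open>W\<close>.\<close>

lemma inv_reflection_at:
  assumes "H \<in> hyperplanes scale W \<rho>"
  shows "inv\<^bsub>W\<^esub> (reflection_at scale W \<rho> H) = reflection_at scale W \<rho> H" (is "inv\<^bsub>W\<^esub> ?s = ?s")
proof -
  have s: "?s \<in> carrier W" by (rule reflection_at_closed[OF assms])
  have "\<rho> (?s \<otimes>\<^bsub>W\<^esub> ?s) = \<rho> \<one>\<^bsub>W\<^esub>"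
    using reflection_at(1)[OF assms] s
    by (simp add: rho_mult rho_one reflections_def is_reflection_def)
  then have "?s \<otimes>\<^bsub>W\<^esub> ?s = \<one>\<^bsub>W\<^esub>"
    using inj_rho s by (simp add: inj_on_eq_iff)
  then show ?thesis using s by (simp add: inv_equality)
qed

text \<open>The conjugate is a reflection whose fixed space is the image of \<open>H\<close>, and a
  reflection is determined by its hyperplane.\<close>

lemma image_hyperplane:
  assumes "H \<in> hyperplanes scale W \<rho>" "w \<in> carrier W"
  shows "\<rho> w ` H \<in> hyperplanes scale W \<rho>"
    and "reflection_at scale W \<rho> (\<rho> w ` H) =
      w \<otimes>\<^bsub>W\<^esub> reflection_at scale W \<rho> H \<otimes>\<^bsub>W\<^esub> inv\<^bsub>W\<^esub> w" (is "_ = ?t")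
proof -
  have t: "?t \<in> reflections scale W \<rho>" "fixed_space \<rho> ?t = \<rho> w ` H"
    using conj_reflection[OF reflection_at(1)[OF assms(1)] assms(2)] reflection_at(2)[OF assms(1)]
    by auto
  show "\<rho> w ` H \<in> hyperplanes scale W \<rho>"
    using t unfolding hyperplanes_def by (metis imageI)
  show "reflection_at scale W \<rho> (\<rho> w ` H) = ?t"
    using reflection_at_eq[OF t(1)] t(2) by simp
qed

section \<open>Divisibility along the hyperplanes\<close>

lemma poly_action_mult:
  "\<lbrakk> g \<in> carrier W; h \<in> carrier W \<rbrakk> \<Longrightarrow>
    poly_action W \<rho> (g \<otimes>\<^bsub>W\<^esub> h) f = poly_action W \<rho> g (poly_action W \<rho> h f)"
  by (simp add: poly_action_def inv_mult_group rho_mult)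

lemma poly_action_one [simp]: "poly_action W \<rho> \<one>\<^bsub>W\<^esub> f = f"
  by (simp add: poly_action_def rho_one)

lemma poly_action_closed:
  "\<lbrakk> f \<in> poly_funs scale; g \<in> carrier W \<rbrakk> \<Longrightarrow> poly_action W \<rho> g f \<in> poly_funs scale"
  unfolding poly_action_def by (simp add: poly_funs_linear_comp linear_rho)

lemma poly_action_reflection_at:
  "H \<in> hyperplanes scale W \<rho> \<Longrightarrow>
    poly_action W \<rho> (reflection_at scale W \<rho> H) f = (\<lambda>x. f (\<rho> (reflection_at scale W \<rho> H) x))"
  by (simp add: poly_action_def inv_reflection_at)

text \<open>The common form of both conditions: exponent 2 k(H) describes quasi-invariants, and
  exponent m(H) describes the identity component of a diagonally invariant quasi-covariant.\<close>

definition refl_dvd :: "('v \<Rightarrow> 'k) \<Rightarrow> 'v set \<Rightarrow> nat \<Rightarrow> bool" where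
  "refl_dvd f H n \<longleftrightarrow> (\<exists>q\<in>poly_funs scale.
    \<forall>x. f (\<rho> (reflection_at scale W \<rho> H) x) - f x = \<alpha> H x ^ n * q x)"

lemma refl_dvd_const: "refl_dvd (\<lambda>x. c) H n"
  unfolding refl_dvd_def by (rule bexI[OF _ poly_funs.const[of 0]]) simp

lemma refl_dvd_add:
  assumes "refl_dvd f H n" "refl_dvd g H n"
  shows "refl_dvd (\<lambda>x. f x + g x) H n"
proof -
  let ?s = "\<rho> (reflection_at scale W \<rho> H)"
  obtain u v where u: "u \<in> poly_funs scale" "\<And>x. f (?s x) - f x = \<alpha> H x ^ n * u x"
    and v: "v \<in> poly_funs scale" "\<And>x. g (?s x) - g x = \<alpha> H x ^ n * v x"
    using assms unfolding refl_dvd_def by blast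
  show ?thesis
    unfolding refl_dvd_def
    by (rule bexI[OF _ poly_funs.add[OF u(1) v(1)]])
      (simp only: add_diff_add u(2) v(2) distrib_left simp_thms)
qed

text \<open>Twisted Leibniz rule again; its cofactor is polynomial because g composed with the
  reflection is.\<close>

lemma refl_dvd_mult:
  assumes "refl_dvd f H n" "refl_dvd g H n" "f \<in> poly_funs scale" "g \<in> poly_funs scale"
    and "H \<in> hyperplanes scale W \<rho>"
  shows "refl_dvd (\<lambda>x. f x * g x) H n"
proof -
  let ?s = "\<rho> (reflection_at scale W \<rho> H)"
  obtain u v where u: "u \<in> poly_funs scale" "\<And>x. f (?s x) - f x = \<alpha> H x ^ n * u x"
    and v: "v \<in> poly_funs scale" "\<And>x. g (?s x) - g x = \<alpha> H x ^ n * v x"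
    using assms unfolding refl_dvd_def by blast
  have "(\<lambda>x. g (?s x)) \<in> poly_funs scale"
    by (rule poly_funs_linear_comp[OF assms(4) linear_rho[OF reflection_at_closed[OF assms(5)]]])
  then have "(\<lambda>x. u x * g (?s x) + f x * v x) \<in> poly_funs scale"
    using assms(3) u(1) v(1) by (intro poly_funs.add poly_funs.mult)
  moreover have "f (?s x) * g (?s x) - f x * g x =
      \<alpha> H x ^ n * (u x * g (?s x) + f x * v x)" for x
  proof -
    have "f (?s x) * g (?s x) - f x * g x = (f (?s x) - f x) * g (?s x) + f x * (g (?s x) - g x)"
      by (simp add: algebra_simps)
    also have "\<dots> = \<alpha> H x ^ n * (u x * g (?s x) + f x * v x)"
      by (simp only: u(2) v(2) distrib_left mult_ac)
    finally show ?thesis .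
  qed
  ultimately show ?thesis
    unfolding refl_dvd_def by (auto intro: rev_bexI)
qed

text \<open>Substituting \<open>inv w\<close> applied to x turns the conjugate reflection back into
  the one at \<open>H\<close>. The chosen forms match only up to a scalar c, whose power c^n goes
  into the cofactor.\<close>

lemma refl_dvd_poly_action:
  assumes f: "refl_dvd f H n" and H: "H \<in> hyperplanes scale W \<rho>" and w: "w \<in> carrier W"
  shows "refl_dvd (poly_action W \<rho> w f) (\<rho> w ` H) n"
proof -
  let ?s = "reflection_at scale W \<rho> H" and ?w' = "\<rho> (inv\<^bsub>W\<^esub> w)"
  note wH = image_hyperplane[OF H w]
  obtain q where q: "q \<in> poly_funs scale" "\<And>x. f (\<rho> ?s x) - f x = \<alpha> H x ^ n * q x"
    using f unfolding refl_dvd_def by blast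
  have w': "Vector_Spaces.linear scale scale ?w'"
    using w by (intro linear_rho inv_closed)
  obtain c where c: "\<alpha> H (?w' x) = c * \<alpha> (\<rho> w ` H) x" for x
  proof (rule linear_forms_same_kernel)
    show "Vector_Spaces.linear scale (*) (\<lambda>x. \<alpha> H (?w' x))"
      using Vector_Spaces.linear_compose[OF w' linear_form[OF H]] by (simp add: comp_def)
    show "Vector_Spaces.linear scale (*) (\<alpha> (\<rho> w ` H))"
      by (rule linear_form[OF wH(1)])
    have "?w' x \<in> H \<longleftrightarrow> x \<in> \<rho> w ` H" for x
      using w rho_inv by (metis image_iff)
    then show "\<alpha> H (?w' x) = 0 \<longleftrightarrow> \<alpha> (\<rho> w ` H) x = 0" for x
      using form_eq_0_iff H wH(1) by blast
  qed (use that in blast)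
  have "poly_action W \<rho> w f (\<rho> (reflection_at scale W \<rho> (\<rho> w ` H)) x) - poly_action W \<rho> w f x =
      \<alpha> (\<rho> w ` H) x ^ n * (c ^ n * q (?w' x))" for x
    using w reflection_at_closed[OF H]
    by (simp add: poly_action_def wH(2) rho_mult q(2) c power_mult_distrib)
  moreover have "(\<lambda>x. c ^ n * q (?w' x)) \<in> poly_funs scale"
    by (rule poly_funs_smult[OF poly_funs_linear_comp[OF q(1) w']])
  ultimately show ?thesis
    unfolding refl_dvd_def by (auto intro: rev_bexI)
qed

text \<open>Accounts for the floor in m/2. For odd n, one direction raises the even exponent by
  anti-invariance; the other moves a factor \<alpha> into the cofactor.\<close>

lemma refl_dvd_even_iff:
  assumes H: "H \<in> hyperplanes scale W \<rho>"
  shows "refl_dvd f H (2 * (n div 2)) \<longleftrightarrow> refl_dvd f H n"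
proof (cases "even n")
  case False
  then have n: "n = Suc (2 * (n div 2))" by simp
  obtain d where "\<And>x. \<rho> (reflection_at scale W \<rho> H) x = x + scale (\<alpha> H x) d" "\<alpha> H d = -2"
  proof (rule is_reflection_formula)
    show "is_reflection scale (\<rho> (reflection_at scale W \<rho> H))"
      using reflection_at(1)[OF H] by (simp add: reflections_def)
    show "Vector_Spaces.linear scale (*) (\<alpha> H)"
      by (rule linear_form[OF H])
    show "{x. \<alpha> H x = 0} = {x. \<rho> (reflection_at scale W \<rho> H) x = x}"
      using form_eq_0_iff[OF H] reflection_at(2)[OF H] by (auto simp: fixed_space_def)
  qed (use that in blast)
  note odd = anti_invariant_dvd_odd_power[OF linear_form[OF H] this]
  have "refl_dvd f H (Suc (2 * (n div 2)))" if dvd: "refl_dvd f H (2 * (n div 2))"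
  proof -
    obtain q where q: "q \<in> poly_funs scale"
      "\<And>x. f (\<rho> (reflection_at scale W \<rho> H) x) - f x = \<alpha> H x ^ (2 * (n div 2)) * q x"
      using dvd unfolding refl_dvd_def by blast
    show ?thesis
      unfolding refl_dvd_def by (rule odd[OF _ q]) simp
  qed
  moreover have "refl_dvd f H (2 * (n div 2))" if dvd: "refl_dvd f H (Suc (2 * (n div 2)))"
  proof -
    obtain q where q: "q \<in> poly_funs scale"
      "\<And>x. f (\<rho> (reflection_at scale W \<rho> H) x) - f x = \<alpha> H x ^ Suc (2 * (n div 2)) * q x"
      using dvd unfolding refl_dvd_def by blast
    then show ?thesis
      unfolding refl_dvd_def using linear_form[OF H]
      by (intro bexI[of _ "\<lambda>x. \<alpha> H x * q x"]) (auto intro: poly_funs.mult poly_funs.form)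
  qed
  ultimately show ?thesis using n by metis
qed simp

section \<open>Quasi-invariants and their stability under the group\<close>

lemma mem_quasi_invariants_iff:
  "f \<in> quasi_invariants scale W \<rho> \<alpha> k \<longleftrightarrow>
    f \<in> poly_funs scale \<and> (\<forall>H\<in>hyperplanes scale W \<rho>. refl_dvd f H (2 * k H))"
  by (auto simp: quasi_invariants_def refl_dvd_def poly_action_reflection_at
      cong_mod_power_coordinate_ring_iff poly_funs.form linear_form)

text \<open>Restores the exponent m(H) itself, so that quasi-invariants and quasi-covariants can be
  compared hyperplane by hyperplane.\<close>

lemma mem_quasi_invariants_div_2_iff:
  "f \<in> quasi_invariants scale W \<rho> \<alpha> (\<lambda>H. m H div 2) \<longleftrightarrow>
    f \<in> poly_funs scale \<and> (\<forall>H\<in>hyperplanes scale W \<rho>. refl_dvd f H (m H))"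
  by (simp add: mem_quasi_invariants_iff refl_dvd_even_iff)

lemma quasi_invariants_closed:
  shows "(\<lambda>x. c) \<in> quasi_invariants scale W \<rho> \<alpha> k"
    and "\<lbrakk> f \<in> quasi_invariants scale W \<rho> \<alpha> k; g \<in> quasi_invariants scale W \<rho> \<alpha> k \<rbrakk> \<Longrightarrow>
      (\<lambda>x. f x + g x) \<in> quasi_invariants scale W \<rho> \<alpha> k"
    and "\<lbrakk> f \<in> quasi_invariants scale W \<rho> \<alpha> k; g \<in> quasi_invariants scale W \<rho> \<alpha> k \<rbrakk> \<Longrightarrow>
      (\<lambda>x. f x * g x) \<in> quasi_invariants scale W \<rho> \<alpha> k"
  by (auto simp: mem_quasi_invariants_iff intro: poly_funs.const poly_funs.add
      poly_funs.mult refl_dvd_const refl_dvd_add refl_dvd_mult)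

lemma quasi_invariants_smult_closed:
  "f \<in> quasi_invariants scale W \<rho> \<alpha> k \<Longrightarrow> (\<lambda>x. c * f x) \<in> quasi_invariants scale W \<rho> \<alpha> k"
  by (rule quasi_invariants_closed(3)[OF quasi_invariants_closed(1)])

text \<open>Take the image of \<open>H\<close> under \<open>inv w\<close>; invariance of
  \<open>m\<close> preserves the multiplicity.\<close>

lemma hyperplane_preimage:
  assumes m: "m \<in> multiplicities scale W \<rho>"
    and H: "H \<in> hyperplanes scale W \<rho>" and w: "w \<in> carrier W"
  obtains H' where "H' \<in> hyperplanes scale W \<rho>" "\<rho> w ` H' = H" "m H' = m H"
proof
  have w': "inv\<^bsub>W\<^esub> w \<in> carrier W" using w by simp
  show "\<rho> (inv\<^bsub>W\<^esub> w) ` H \<in> hyperplanes scale W \<rho>"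
    by (rule image_hyperplane(1)[OF H w'])
  show "\<rho> w ` \<rho> (inv\<^bsub>W\<^esub> w) ` H = H"
    using w by (simp add: image_image)
  show "m (\<rho> (inv\<^bsub>W\<^esub> w) ` H) = m H"
    using m H w' by (simp add: multiplicities_def)
qed

text \<open>The condition at \<open>H\<close> is transported from the preimage of \<open>H\<close>
  under w, where f satisfies it with the same exponent.\<close>

lemma poly_action_refl_dvd:
  assumes m: "m \<in> multiplicities scale W \<rho>"
    and f: "\<forall>H\<in>hyperplanes scale W \<rho>. refl_dvd f H (m H)"
    and H: "H \<in> hyperplanes scale W \<rho>" and w: "w \<in> carrier W"
  shows "refl_dvd (poly_action W \<rho> w f) H (m H)"
  using hyperplane_preimage[OF m H w] refl_dvd_poly_action[OF _ _ w] f by metis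

lemma poly_action_quasi_invariants:
  assumes "m \<in> multiplicities scale W \<rho>"
    and "f \<in> quasi_invariants scale W \<rho> \<alpha> (\<lambda>H. m H div 2)" and "w \<in> carrier W"
  shows "poly_action W \<rho> w f \<in> quasi_invariants scale W \<rho> \<alpha> (\<lambda>H. m H div 2)"
  using assms by (auto simp: mem_quasi_invariants_div_2_iff poly_action_closed poly_action_refl_dvd)

section \<open>Diagonal invariants as families of translates\<close>

text \<open>The family of all w(f), that is, the sum of w(f) tensor w: the inverse of evaluation at
  the identity on diagonal invariants.\<close>

definition translates :: "('v \<Rightarrow> 'k) \<Rightarrow> 'w \<Rightarrow> 'v \<Rightarrow> 'k" where
  "translates f = (\<lambda>w\<in>carrier W. poly_action W \<rho> w f)"

lemma translates_one [simp]: "translates f \<one>\<^bsub>W\<^esub> = f"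
  by (simp add: translates_def)

lemma carrier_diagonal_invariant_algebra:
  assumes m: "m \<in> multiplicities scale W \<rho>"
  shows "carrier (diagonal_invariant_algebra scale W \<rho> \<alpha> m) =
    translates ` quasi_invariants scale W \<rho> \<alpha> (\<lambda>H. m H div 2)"
proof (intro equalityI subsetI)
  fix p assume "p \<in> carrier (diagonal_invariant_algebra scale W \<rho> \<alpha> m)"
  then have p: "p \<in> carrier W \<rightarrow>\<^sub>E poly_funs scale"
    and cong: "\<And>H w. \<lbrakk> H \<in> hyperplanes scale W \<rho>; w \<in> carrier W \<rbrakk> \<Longrightarrow>
      cong_mod_power (coordinate_ring scale) (\<alpha> H) (m H) (p w)
        (p (reflection_at scale W \<rho> H \<otimes>\<^bsub>W\<^esub> w))"
    and inv: "\<And>g. g \<in> carrier W \<Longrightarrow> diagonal_action W \<rho> g p = p"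
    by (auto simp: diagonal_invariant_algebra_def quasi_covariants_def)
  \<comment> \<open>Invariance under w itself, read at the component w, where \<open>inv w\<close>
    times w is the identity.\<close>
  have pw: "p w = poly_action W \<rho> w (p \<one>\<^bsub>W\<^esub>)" if "w \<in> carrier W" for w
    using fun_cong[OF inv[OF that], of w] that by (simp add: diagonal_action_def)
  have "refl_dvd (p \<one>\<^bsub>W\<^esub>) H (m H)" if H: "H \<in> hyperplanes scale W \<rho>" for H
  proof -
    let ?s = "reflection_at scale W \<rho> H"
    have s: "?s \<in> carrier W" by (rule reflection_at_closed[OF H])
    have ps: "p ?s = (\<lambda>x. p \<one>\<^bsub>W\<^esub> (\<rho> ?s x))"
      using pw[OF s] poly_action_reflection_at[OF H] by simp
    have "p ?s \<in> poly_funs scale" using p s by auto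
    then obtain q where q: "q \<in> poly_funs scale"
      "\<And>x. p \<one>\<^bsub>W\<^esub> x - p \<one>\<^bsub>W\<^esub> (\<rho> ?s x) = \<alpha> H x ^ m H * q x"
      using cong[OF H, of "\<one>\<^bsub>W\<^esub>"] s linear_form[OF H]
      by (auto simp: cong_mod_power_coordinate_ring_iff poly_funs.form ps)
    \<comment> \<open>The congruence subtracts in the opposite order to \<open>refl_dvd\<close>,
      hence the cofactor -q.\<close>
    then show ?thesis
      unfolding refl_dvd_def
      by (intro bexI[of _ "\<lambda>x. - q x"]) (simp_all add: poly_funs_uminus flip: q(2))
  qed
  moreover have "p \<one>\<^bsub>W\<^esub> \<in> poly_funs scale"
    using p by auto
  \<comment> \<open>Outside the group both sides take the default value of extensional
    functions.\<close>
  moreover have "p = translates (p \<one>\<^bsub>W\<^esub>)"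
  proof
    fix w show "p w = translates (p \<one>\<^bsub>W\<^esub>) w"
      by (cases "w \<in> carrier W") (simp_all add: translates_def PiE_arb[OF p] flip: pw)
  qed
  ultimately show "p \<in> translates ` quasi_invariants scale W \<rho> \<alpha> (\<lambda>H. m H div 2)"
    using mem_quasi_invariants_div_2_iff by blast
next
  fix p assume "p \<in> translates ` quasi_invariants scale W \<rho> \<alpha> (\<lambda>H. m H div 2)"
  then obtain f where f: "f \<in> poly_funs scale"
    and dvd: "\<forall>H\<in>hyperplanes scale W \<rho>. refl_dvd f H (m H)" and p: "p = translates f"
    by (auto simp: mem_quasi_invariants_div_2_iff)
  have "cong_mod_power (coordinate_ring scale) (\<alpha> H) (m H) (p w)
      (p (reflection_at scale W \<rho> H \<otimes>\<^bsub>W\<^esub> w))"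
    if H: "H \<in> hyperplanes scale W \<rho>" and w: "w \<in> carrier W" for H w
  proof -
    let ?s = "reflection_at scale W \<rho> H"
    have s: "?s \<in> carrier W" by (rule reflection_at_closed[OF H])
    have ps: "p (?s \<otimes>\<^bsub>W\<^esub> w) = (\<lambda>x. p w (\<rho> ?s x))"
      using s w poly_action_reflection_at[OF H] by (simp add: p translates_def poly_action_mult)
    have closed: "p (?s \<otimes>\<^bsub>W\<^esub> w) \<in> poly_funs scale"
      using f s w by (simp add: p translates_def poly_action_closed)
    have "refl_dvd (p w) H (m H)"
      using poly_action_refl_dvd[OF m dvd H w] w by (simp add: p translates_def)
    then obtain q where q: "q \<in> poly_funs scale"
      "\<And>x. p w (\<rho> ?s x) - p w x = \<alpha> H x ^ m H * q x"
      unfolding refl_dvd_def by blast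
    then have "\<exists>q\<in>poly_funs scale. \<forall>x. p w x - p w (\<rho> ?s x) = \<alpha> H x ^ m H * q x"
      by (intro bexI[of _ "\<lambda>x. - q x"]) (simp_all add: poly_funs_uminus flip: q(2))
    then show ?thesis
      using closed linear_form[OF H]
      by (simp add: cong_mod_power_coordinate_ring_iff poly_funs.form ps)
  qed
  \<comment> \<open>Acting by g on the component at \<open>inv g\<close> times w gives back
    w(f).\<close>
  moreover have "diagonal_action W \<rho> g p = p" if "g \<in> carrier W" for g
    using that
    by (auto simp: diagonal_action_def p translates_def fun_eq_iff m_assoc[symmetric]
        simp flip: poly_action_mult)
  ultimately show "p \<in> carrier (diagonal_invariant_algebra scale W \<rho> \<alpha> m)"
    using f by (simp add: diagonal_invariant_algebra_def quasi_covariants_def)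
      (simp add: p translates_def poly_action_closed)
qed

text \<open>The component at w becomes (w g)(f) = w(g(f)), so the right action on families is the
  usual action on f.\<close>

lemma right_action_translates:
  "g \<in> carrier W \<Longrightarrow> right_action W g (translates f) = translates (poly_action W \<rho> g f)"
  by (auto simp: right_action_def translates_def poly_action_mult fun_eq_iff)

section \<open>Algebra structures, group actions and the isomorphism\<close>

lemma quasi_invariant_algebra_simps:
  "carrier (quasi_invariant_algebra scale W \<rho> \<alpha> k) = quasi_invariants scale W \<rho> \<alpha> k"
  "f \<otimes>\<^bsub>quasi_invariant_algebra scale W \<rho> \<alpha> k\<^esub> g = (\<lambda>x. f x * g x)"
  "\<one>\<^bsub>quasi_invariant_algebra scale W \<rho> \<alpha> k\<^esub> = (\<lambda>x. 1)"
  "f \<oplus>\<^bsub>quasi_invariant_algebra scale W \<rho> \<alpha> k\<^esub> g = (\<lambda>x. f x + g x)"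
  "c \<odot>\<^bsub>quasi_invariant_algebra scale W \<rho> \<alpha> k\<^esub> f = (\<lambda>x. c * f x)"
  by (simp_all add: quasi_invariant_algebra_def coordinate_ring_def)

text \<open>Each w acts by composition, which commutes with pointwise operations; computations with
  families thus reduce to single functions.\<close>

lemma diagonal_invariant_algebra_simps:
  "translates f \<otimes>\<^bsub>diagonal_invariant_algebra scale W \<rho> \<alpha> m\<^esub> translates g =
    translates (\<lambda>x. f x * g x)"
  "\<one>\<^bsub>diagonal_invariant_algebra scale W \<rho> \<alpha> m\<^esub> = translates (\<lambda>x. 1)"
  "translates f \<oplus>\<^bsub>diagonal_invariant_algebra scale W \<rho> \<alpha> m\<^esub> translates g =
    translates (\<lambda>x. f x + g x)"
  "c \<odot>\<^bsub>diagonal_invariant_algebra scale W \<rho> \<alpha> m\<^esub> translates f = translates (\<lambda>x. c * f x)"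
  by (auto simp: diagonal_invariant_algebra_def product_algebra_def translates_def
      poly_action_def Let_def fun_eq_iff)

lemma quasi_invariant_action:
  assumes m: "m \<in> multiplicities scale W \<rho>"
  shows "group_algebra_action ring_of_type_algebra W
    (quasi_invariant_algebra scale W \<rho> \<alpha> (\<lambda>H. m H div 2)) (poly_action W \<rho>)"
  unfolding group_algebra_action_def
proof (intro conjI ballI)
  show "algebra ring_of_type_algebra (quasi_invariant_algebra scale W \<rho> \<alpha> (\<lambda>H. m H div 2))"
    unfolding quasi_invariant_algebra_def
    by (rule algebra.subalgebra_algebra[OF algebra_coordinate_ring])
      (auto simp: quasi_invariants_closed quasi_invariants_smult_closed,
       simp add: mem_quasi_invariants_iff)
  show "group_action W (carrier (quasi_invariant_algebra scale W \<rho> \<alpha> (\<lambda>H. m H div 2)))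
    (\<lambda>g. restrict (poly_action W \<rho> g)
      (carrier (quasi_invariant_algebra scale W \<rho> \<alpha> (\<lambda>H. m H div 2))))"
    by (rule group_actionI)
      (auto simp: quasi_invariant_algebra_simps poly_action_mult group_axioms
        poly_action_quasi_invariants[OF m])
  show "poly_action W \<rho> g \<in> ring_hom
      (quasi_invariant_algebra scale W \<rho> \<alpha> (\<lambda>H. m H div 2))
      (quasi_invariant_algebra scale W \<rho> \<alpha> (\<lambda>H. m H div 2))" if "g \<in> carrier W" for g
    by (rule ring_hom_memI)
      (auto simp: quasi_invariant_algebra_simps poly_action_quasi_invariants[OF m _ that],
       auto simp: poly_action_def)
qed (auto simp: quasi_invariant_algebra_simps poly_action_def)

lemma diagonal_invariant_action:
  assumes m: "m \<in> multiplicities scale W \<rho>"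
  shows "group_algebra_action ring_of_type_algebra W
    (diagonal_invariant_algebra scale W \<rho> \<alpha> m) (right_action W)"
  unfolding group_algebra_action_def
proof (intro conjI ballI)
  let ?D = "diagonal_invariant_algebra scale W \<rho> \<alpha> m"
  note carr = carrier_diagonal_invariant_algebra[OF m]
  note ops = diagonal_invariant_algebra_simps
  have upd: "?D = (product_algebra scale W)\<lparr>carrier := carrier ?D\<rparr>"
    by (simp add: diagonal_invariant_algebra_def)
  show "algebra ring_of_type_algebra ?D"
  proof (subst upd, rule algebra.subalgebra_algebra[OF algebra_product_algebra])
    show "carrier ?D \<subseteq> carrier (product_algebra scale W)"
      by (auto simp: diagonal_invariant_algebra_def quasi_covariants_def)
    \<comment> \<open>Both algebras share their operations; naming them through \<open>?D\<close>
      makes the rules for \<open>translates\<close> applicable.\<close>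
    have D: "\<one>\<^bsub>product_algebra scale W\<^esub> = \<one>\<^bsub>?D\<^esub>"
      "x \<otimes>\<^bsub>product_algebra scale W\<^esub> y = x \<otimes>\<^bsub>?D\<^esub> y"
      "x \<oplus>\<^bsub>product_algebra scale W\<^esub> y = x \<oplus>\<^bsub>?D\<^esub> y"
      "c \<odot>\<^bsub>product_algebra scale W\<^esub> x = c \<odot>\<^bsub>?D\<^esub> x" for x y c
      by (simp_all add: diagonal_invariant_algebra_def del: product_algebra_simps)
    show "\<one>\<^bsub>product_algebra scale W\<^esub> \<in> carrier ?D"
      "\<And>x y. \<lbrakk> x \<in> carrier ?D; y \<in> carrier ?D \<rbrakk> \<Longrightarrow> x \<otimes>\<^bsub>product_algebra scale W\<^esub> y \<in> carrier ?D"
      "\<And>x y. \<lbrakk> x \<in> carrier ?D; y \<in> carrier ?D \<rbrakk> \<Longrightarrow> x \<oplus>\<^bsub>product_algebra scale W\<^esub> y \<in> carrier ?D"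
      "\<And>c x. \<lbrakk> c \<in> carrier ring_of_type_algebra; x \<in> carrier ?D \<rbrakk> \<Longrightarrow>
        c \<odot>\<^bsub>product_algebra scale W\<^esub> x \<in> carrier ?D"
      unfolding D carr
      by (auto simp: ops quasi_invariants_closed quasi_invariants_smult_closed)
  qed
  show "group_action W (carrier ?D) (\<lambda>g. restrict (right_action W g) (carrier ?D))"
    by (rule group_actionI)
      (auto simp: carr right_action_translates poly_action_mult group_axioms
        poly_action_quasi_invariants[OF m])
  show "right_action W g \<in> ring_hom ?D ?D" if "g \<in> carrier W" for g
    by (rule ring_hom_memI)
      (auto simp: carr ops right_action_translates[OF that] poly_action_quasi_invariants[OF m _ that],
       auto simp: poly_action_def)
qed (auto simp: carrier_diagonal_invariant_algebra[OF m] diagonal_invariant_algebra_simps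
      right_action_translates, simp add: poly_action_def)

text \<open>Every invariant family is \<open>translates f\<close> for a quasi-invariant f, and its
  value at the identity is f, so evaluation is bijective; equivariance is
  \<open>right_action_translates\<close>.\<close>

lemma evaluation_at_one_iso:
  assumes m: "m \<in> multiplicities scale W \<rho>"
  shows "(\<lambda>p. p \<one>\<^bsub>W\<^esub>) \<in> equivariant_algebra_isos ring_of_type_algebra W
    (diagonal_invariant_algebra scale W \<rho> \<alpha> m) (right_action W)
    (quasi_invariant_algebra scale W \<rho> \<alpha> (\<lambda>H. m H div 2)) (poly_action W \<rho>)"
  by (auto simp: equivariant_algebra_isos_def ring_iso_def ring_hom_def bij_betw_def inj_on_def
      image_image carrier_diagonal_invariant_algebra[OF m] diagonal_invariant_algebra_simps
      quasi_invariant_algebra_simps right_action_translates)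

end

theorem lemma2p8:
  fixes scale :: "'k::field_char_0 \<Rightarrow> 'v::ab_group_add \<Rightarrow> 'v"
    and Basis :: "'v set"
    and W :: "('w, 'x) monoid_scheme"
    and S :: "'w set"
    and \<rho> :: "'w \<Rightarrow> 'v \<Rightarrow> 'v"
    and \<alpha> :: "'v set \<Rightarrow> 'v \<Rightarrow> 'k"
  assumes "finite_dimensional_vector_space scale Basis"
    and "coxeter_system W S"
    and "finite (carrier W)"
    and "reflection_representation scale W S \<rho>"
    and "defining_forms scale W \<rho> \<alpha>"
  shows
    "\<exists>\<Phi>.
      (\<forall>m\<in>multiplicities scale W \<rho>.
        group_algebra_action ring_of_type_algebra W
          (diagonal_invariant_algebra scale W \<rho> \<alpha> m) (right_action W) \<and>
        group_algebra_action ring_of_type_algebra W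
          (quasi_invariant_algebra scale W \<rho> \<alpha> (\<lambda>H. m H div 2)) (poly_action W \<rho>) \<and>
        \<Phi> m \<in> equivariant_algebra_isos ring_of_type_algebra W
          (diagonal_invariant_algebra scale W \<rho> \<alpha> m) (right_action W)
          (quasi_invariant_algebra scale W \<rho> \<alpha> (\<lambda>H. m H div 2)) (poly_action W \<rho>)) \<and>
      (\<forall>m\<in>multiplicities scale W \<rho>. \<forall>m'\<in>multiplicities scale W \<rho>.
        (\<forall>H\<in>hyperplanes scale W \<rho>. m H \<le> m' H) \<longrightarrow>
        (\<forall>p\<in>carrier (diagonal_invariant_algebra scale W \<rho> \<alpha> m'). \<Phi> m p = \<Phi> m' p))"
proof -
  interpret faithful_linear_group scale Basis W \<rho> \<alpha>
    using assms unfolding faithful_linear_group_def faithful_linear_group_axioms_def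
      coxeter_system_def reflection_representation_def by blast
  \<comment> \<open>Evaluation at the identity serves for every m at once, so compatibility with a
    comparison of multiplicities is reflexivity.\<close>
  show ?thesis
    by (intro exI[of _ "\<lambda>m p. p \<one>\<^bsub>W\<^esub>"] conjI ballI impI refl diagonal_invariant_action
        quasi_invariant_action evaluation_at_one_iso)
qed

end
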